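(* Let $n,k\ge1$ be integers with $k\le n/4$. Then there exists an avoidance coupling for $k$ walkers on $K_n^*$.
   Context: $K_n^*$ is the complete graph on $n$ vertices with a single self-loop at each vertex; a random walk on it moves at each step to a uniformly random vertex among all $n$ (so it stays in place with probability $1/n$). Walkers $1,\dots,k$ take turns to move in discrete time in the fixed cyclic order $X^{(1)}_0,\dots,X^{(k)}_0,X^{(1)}_1,\dots,X^{(k)}_1,\dots$. A coupling is a realization of all the walks on a common probability space such that each $(X^{(j)}_t)_{t\ge0}$, viewed separately, is a random walk on the graph (the initial states may be coupled in an arbitrary way). A collision occurs exactly if a walker moves to a vertex currently occupied by another; i.e. the collisions are the events $X^{(i)}_t=X^{(j)}_t$ for $i\ne j$ and $X^{(i)}_{t+1}=X^{(j)}_t$ for $i<j$ ($t\ge 0$). An avoidance coupling is a coupling in which (almost surely) no collision ever occurs (not necessarily Markovian). *)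

theory Defs
  imports "HOL-Probability.Probability"
begin

text \<open>
  An undirected graph, possibly with self-loops, is a pair of a vertex set and a symmetric edge
  relation; a loop at \<open>u\<close> is the pair \<open>(u, u)\<close>, so it adds one neighbour to \<open>u\<close>.
\<close>

type_synonym 'v ugraph = "'v set \<times> ('v \<times> 'v) set"

definition complete_loop_graph :: "nat \<Rightarrow> nat ugraph" where
  "complete_loop_graph n = ({..<n}, {..<n} \<times> {..<n})"

text \<open>
  The Markov property of the walk, with conditional probabilities multiplied out so that
  histories of probability zero need no special treatment.  The law of the initial state
  is not restricted.  The definition is meant for graphs in which every vertex has a finite
  nonempty set of neighbours.
\<close>

definition random_walk :: "'w measure \<Rightarrow> 'v ugraph \<Rightarrow> (nat \<Rightarrow> 'w \<Rightarrow> 'v) \<Rightarrow> bool" where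
  "random_walk M G X \<longleftrightarrow>
     (\<forall>t. X t \<in> M \<rightarrow>\<^sub>M count_space (fst G)) \<and>
     (\<forall>t x. (\<forall>s\<le>Suc t. x s \<in> fst G) \<longrightarrow>
        measure M {w \<in> space M. \<forall>s\<le>Suc t. X s w = x s} =
        measure M {w \<in> space M. \<forall>s\<le>t. X s w = x s} *
          pmf (pmf_of_set (snd G `` {x t})) (x (Suc t)))"

text \<open>
  \<open>X j t\<close> is the position of walker \<open>j\<close> after its \<open>t\<close>-th move; the walkers are \<open>1, \<dots>, k\<close>.
\<close>

definition coupling ::
    "'w measure \<Rightarrow> 'v ugraph \<Rightarrow> nat \<Rightarrow> (nat \<Rightarrow> nat \<Rightarrow> 'w \<Rightarrow> 'v) \<Rightarrow> bool" where
  "coupling M G k X \<longleftrightarrow> prob_space M \<and> (\<forall>j\<in>{1..k}. random_walk M G (X j))"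

text \<open>
  When walker \<open>i\<close> makes its move number \<open>t + 1\<close>, the walkers \<open>j > i\<close> have not yet made theirs,
  hence the comparison of \<open>X i (Suc t)\<close> with \<open>X j t\<close>.
\<close>

definition avoidance_coupling ::
    "'w measure \<Rightarrow> 'v ugraph \<Rightarrow> nat \<Rightarrow> (nat \<Rightarrow> nat \<Rightarrow> 'w \<Rightarrow> 'v) \<Rightarrow> bool" where
  "avoidance_coupling M G k X \<longleftrightarrow>
     coupling M G k X \<and>
     (AE w in M. \<forall>t. \<forall>i\<in>{1..k}. \<forall>j\<in>{1..k}.
        (i \<noteq> j \<longrightarrow> X i t w \<noteq> X j t w) \<and>
        (i < j \<longrightarrow> X i (Suc t) w \<noteq> X j t w))"

text \<open>
  HOL cannot quantify existentially over the type of sample points.  Nothing is lost by taking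
  them to be joint trajectories (walker, time) \<open>\<mapsto>\<close> vertex: a coupling on any probability space
  can be replaced by its joint law on trajectories with the coordinate maps as walks.
\<close>

definition has_avoidance_coupling :: "'v ugraph \<Rightarrow> nat \<Rightarrow> bool" where
  "has_avoidance_coupling G k \<longleftrightarrow>
     (\<exists>(M :: (nat \<Rightarrow> nat \<Rightarrow> 'v) measure) X. avoidance_coupling M G k X)"

end

theory Submission
  imports Defs
begin

text \<open>
  Let \<open>m = 2 ^ (d + 1)\<close> be the largest power of two with \<open>m \<le> n\<close>.  Then \<open>k \<le> 2 ^ d\<close> and
  \<open>n \<le> 2 * m\<close>, and the walks are built in two stages.

  First take \<open>2 ^ d\<close> walkers on \<open>m\<close> vertices, the vertices being bit vectors of length \<open>d + 1\<close>.
  All walkers read their bits from a single array of independent fair bits indexed by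
  time and coordinate.  Walker \<open>j\<close> owns a word whose entry \<open>(g, s)\<close> at coordinate \<open>c\<close> says that at
  time \<open>t\<close> its \<open>c\<close>-th bit is the array bit at \<open>(t + g, c)\<close>, negated if \<open>s\<close> holds.  A
  single walker never uses an array entry twice, so its positions are independent and uniform,
  whatever its word is.  Two walkers whose entries in some coordinate are \<open>(g, s)\<close> and
  \<open>(g, \<not> s)\<close> always show opposite bits there, so they are apart whenever both have made
  the same number of moves.  If walker \<open>i\<close> has the entry \<open>(g, s)\<close> and walker \<open>j\<close> the entry
  \<open>(g + 1, \<not> s)\<close>, then \<open>i\<close> at time \<open>t + 1\<close> and \<open>j\<close> at time \<open>t\<close> read the same array entry
  with opposite signs, so \<open>i\<close> does not step on \<open>j\<close>.  It therefore suffices to find \<open>2 ^ d\<close>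
  words such that every pair \<open>i < j\<close> has a coordinate of each kind (\<open>family_separated\<close>).
  These words come from a doubling construction that carries along a second list of words
  agreeing with each word of the first somewhere (\<open>families_meet\<close>).

  To pass from \<open>m\<close> to \<open>n\<close> vertices, run two independent copies \<open>Y\<close>, \<open>Z\<close> of this coupling
  with the same words.  A walker sits at \<open>m + Z\<close> if \<open>Z < n - m\<close> and an independent coin of
  success probability \<open>m / n\<close> allows it, and at \<open>Y\<close> otherwise.  This is uniform on \<open>n\<close>
  vertices (\<open>equidistributes_select\<close>), and since both copies keep the walkers apart, two
  walkers can meet neither among the first \<open>m\<close> vertices nor among the others, however their
  coins depend on each other (\<open>select_neq\<close>).
\<close>

section \<open>Words keeping the walkers apart\<close>

text \<open>
  A word entry \<open>(g, s)\<close> consists of a look-ahead \<open>g\<close> and a sign \<open>s\<close>.  A flip keeps two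
  walkers apart after equally many moves, an advance keeps the earlier walker, once it
  has moved, away from the later one, which has not.
\<close>

definition flip :: "nat \<times> bool \<Rightarrow> nat \<times> bool" where
  "flip x = (fst x, \<not> snd x)"

definition advance :: "nat \<times> bool \<Rightarrow> nat \<times> bool" where
  "advance x = (Suc (fst x), \<not> snd x)"

text \<open>
  The lists \<open>family False d\<close> and \<open>family True d\<close> are built simultaneously.  Within each half of
  the doubled list the words are separated by induction.  Across the halves the new
  coordinate supplies a flip.  The old coordinates must supply an advance; this
  is why the second half is the advanced copy of the \<^emph>\<open>other\<close> list, whose words agree with
  those of the first half somewhere.
\<close>

fun family :: "bool \<Rightarrow> nat \<Rightarrow> (nat \<times> bool) list list" where
  "family b 0 = [[(0, False)]]"
| "family b (Suc d) =
     map ((#) (0, b)) (family b d) @ map ((#) (0, \<not> b) \<circ> map advance) (family (\<not> b) d)"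

definition separated :: "(nat \<times> bool) list \<Rightarrow> (nat \<times> bool) list \<Rightarrow> bool" where
  "separated v w \<longleftrightarrow>
     (\<exists>x. (x, flip x) \<in> set (zip v w)) \<and> (\<exists>x. (x, advance x) \<in> set (zip v w))"

lemma length_family [simp]: "length (family b d) = 2 ^ d"
  by (induction b d rule: family.induct) auto

lemma length_word_family: "w \<in> set (family b d) \<Longrightarrow> length w = Suc d"
  by (induction b d arbitrary: w rule: family.induct) auto

lemma advance_flip: "advance (flip x) = flip (advance x)"
  by (simp add: flip_def advance_def)

lemma separated_map_advance:
  assumes "separated v w"
  shows "separated (map advance v) (map advance w)"
proof -
  obtain x y where x: "(x, flip x) \<in> set (zip v w)" and y: "(y, advance y) \<in> set (zip v w)"
    using assms by (auto simp: separated_def)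
  have "(advance a, advance b) \<in> set (zip (map advance v) (map advance w))"
    if "(a, b) \<in> set (zip v w)" for a b
    using that by (force simp: zip_map_map)
  from this[OF x] this[OF y] show ?thesis
    unfolding separated_def advance_flip by blast
qed

lemma separated_Cons: "separated v w \<Longrightarrow> separated (a # v) (b # w)"
  by (auto simp: separated_def)

text \<open>
  Two halves that carry the same entry in the new coordinate agree there, and the remaining
  pairs of halves carry the induction hypothesis, since advancing both words
  preserves an agreement.
\<close>

lemma families_meet:
  assumes "v \<in> set (family b d)" "w \<in> set (family (\<not> b) d)"
  shows "\<exists>x. (x, x) \<in> set (zip v w)"
  using assms
proof (induction d arbitrary: v w b)
  case 0
  then show ?case by auto
next
  case (Suc d)
  have old: "\<exists>x. (x, x) \<in> set (zip (f # v') (g # w'))"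
    if "v' \<in> set (family b d)" "w' \<in> set (family (\<not> b) d)" for v' w' f g
    using Suc.IH[OF that] by auto
  have new: "\<exists>x. (x, x) \<in> set (zip (f # map advance v') (g # map advance w'))"
    if "v' \<in> set (family (\<not> b) d)" "w' \<in> set (family b d)" for v' w' f g
  proof -
    have "\<exists>x. (x, x) \<in> set (zip v' w')"
      using Suc.IH[of v' "\<not> b" w'] that by simp
    then obtain x where "(x, x) \<in> set (zip v' w')" by blast
    then have "(advance x, advance x) \<in> set (zip (map advance v') (map advance w'))"
      by (force simp: zip_map_map)
    then show ?thesis by (auto simp del: split_paired_Ex)
  qed
  have same: "\<exists>x. (x, x) \<in> set (zip (f # v') (f # w'))" for f v' w'
    by auto
  from Suc.prems show ?case
    unfolding family.simps set_append set_map Un_iff image_iff o_def not_not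
    using old new same by (elim disjE bexE) (simp_all only:)
qed

lemma family_separated: "sorted_wrt separated (family b d)"
proof (induction d arbitrary: b)
  case 0
  then show ?case by simp
next
  case (Suc d)
  have cross: "separated ((0, b) # v) ((0, \<not> b) # map advance w)"
    if vw: "v \<in> set (family b d)" "w \<in> set (family (\<not> b) d)" for v w
  proof -
    obtain x where "(x, x) \<in> set (zip v w)"
      using families_meet[OF vw] by blast
    then have "(x, advance x) \<in> set (zip v (map advance w))"
      by (force simp: zip_map2)
    moreover have "flip (0, b) = (0, \<not> b)"
      by (simp add: flip_def)
    ultimately show ?thesis
      unfolding separated_def by (metis list.set_intros zip_Cons_Cons)
  qed
  have "sorted_wrt separated (map ((#) (0, b)) (family b d))"
    unfolding sorted_wrt_map by (rule sorted_wrt_mono_rel[OF _ Suc.IH]) (rule separated_Cons)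
  moreover have "sorted_wrt separated (map ((#) (0, \<not> b) \<circ> map advance) (family (\<not> b) d))"
    unfolding sorted_wrt_map o_def
    by (rule sorted_wrt_mono_rel[OF _ Suc.IH]) (intro separated_Cons separated_map_advance)
  ultimately show ?case
    using cross by (auto simp: sorted_wrt_append)
qed

section \<open>Random walks read off an array of independent symbols\<close>

lemma (in prob_space) prob_finite_block:
  fixes V :: "nat \<times> 'c \<Rightarrow> 'a \<Rightarrow> 'v" and g :: "'c \<Rightarrow> nat"
  assumes ind: "indep_vars (\<lambda>i. count_space (Q (snd i))) V UNIV"
    and unif: "\<And>i v. v \<in> Q (snd i) \<Longrightarrow> prob (V i -` {v} \<inter> space M) = 1 / card (Q (snd i))"
    and C: "finite C" "C \<noteq> {}" and Q: "\<And>c. finite (Q c)"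
    and A: "A \<subseteq> PiE C Q"
  shows "prob {w \<in> space M. (\<lambda>c\<in>C. V (s + g c, c) w) \<in> A} = card A / card (PiE C Q)"
proof -
  let ?r = "\<lambda>c. (s + g c, c)"
  have inj: "inj_on ?r C" by (auto simp: inj_on_def)
  let ?E = "\<lambda>v. \<Inter>i\<in>?r ` C. V i -` {v (snd i)} \<inter> space M"
  have V: "V i \<in> M \<rightarrow>\<^sub>M count_space (Q (snd i))" for i
    using ind unfolding indep_vars_def by blast
  have finA: "finite A" 
    using A C Q by (meson finite_PiE finite_subset)
  have AQ: "v c \<in> Q c" if "v \<in> A" "c \<in> C" for v c
    using that A by auto
  have point: "prob (?E v) = 1 / card (PiE C Q)" if "v \<in> A" for v
  proof -
    note v = AQ[OF that]
    have "prob (?E v) = (\<Prod>i\<in>?r ` C. prob (V i -` {v (snd i)} \<inter> space M))"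
      by (intro indep_varsD[OF ind]) (use C v in auto)
    also have "\<dots> = (\<Prod>c\<in>C. 1 / card (Q c))"
      by (simp add: prod.reindex[OF inj] unif v)
    also have "\<dots> = 1 / card (PiE C Q)"
      using C by (simp add: card_PiE prod_dividef)
    finally show ?thesis .
  qed
  have "{w \<in> space M. (\<lambda>c\<in>C. V (s + g c, c) w) \<in> A} = (\<Union>v\<in>A. ?E v)"
  proof (intro equalityI subsetI)
    fix w assume w: "w \<in> (\<Union>v\<in>A. ?E v)"
    then obtain v where v: "v \<in> A" "w \<in> ?E v" by blast
    then have "V (s + g c, c) w = v c" if "c \<in> C" for c
      using INT_D[OF v(2) imageI[OF that, of ?r]] by simp
    then have "(\<lambda>c\<in>C. V (s + g c, c) w) = v"
      using A v(1) by (intro extensionalityI[of _ C]) (auto simp: PiE_def)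
    then show "w \<in> {w \<in> space M. (\<lambda>c\<in>C. V (s + g c, c) w) \<in> A}"
      using v C by auto
  next
    fix w assume "w \<in> {w \<in> space M. (\<lambda>c\<in>C. V (s + g c, c) w) \<in> A}"
    then show "w \<in> (\<Union>v\<in>A. ?E v)"
      by (intro UN_I[of "\<lambda>c\<in>C. V (s + g c, c) w"]) auto
  qed
  moreover have "prob (\<Union>v\<in>A. ?E v) = (\<Sum>v\<in>A. prob (?E v))"
  proof (rule finite_measure_finite_Union[OF finA])
    show "?E ` A \<subseteq> events"
    proof (intro subsetI, elim imageE)
      fix X v assume X: "X = ?E v" "v \<in> A"
      show "X \<in> events"
        unfolding X(1)
        using C by (intro sets.finite_INT measurable_sets[OF V]) (auto intro: AQ[OF X(2)])
    qed
    show "disjoint_family_on ?E A"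
      unfolding disjoint_family_on_def
    proof (intro ballI impI)
      fix u v assume uv: "u \<in> A" "v \<in> A" "u \<noteq> v"
      then obtain c where "c \<in> C" "u c \<noteq> v c"
        using A by (metis PiE_ext subsetD)
      then show "?E u \<inter> ?E v = {}" by auto
    qed
  qed
  ultimately show ?thesis using point by simp
qed

text \<open>
  A vertex of the complete graph with loops has all \<open>n\<close> vertices as neighbours, so a step
  forgets the current position.
\<close>

lemma (in prob_space) random_walk_of_iid_uniform:
  assumes "0 < n"
    and ind: "indep_vars (\<lambda>_. count_space {..<n}) Z UNIV"
    and unif: "\<And>s x. x < n \<Longrightarrow> prob (Z s -` {x} \<inter> space M) = 1 / n"
  shows "random_walk M (complete_loop_graph n) Z"
proof -
  have Z: "Z t \<in> M \<rightarrow>\<^sub>M count_space {..<n}" for t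
    using ind by (auto simp: indep_vars_def)
  have cyl: "prob {w \<in> space M. \<forall>s\<le>t. Z s w = x s} = (1 / n) ^ Suc t"
    if x: "\<And>s. s \<le> t \<Longrightarrow> x s < n" for t x
  proof -
    have "{w \<in> space M. \<forall>s\<le>t. Z s w = x s} = (\<Inter>s\<in>{..t}. Z s -` {x s} \<inter> space M)"
      by auto
    also have "prob \<dots> = (\<Prod>s\<in>{..t}. prob (Z s -` {x s} \<inter> space M))"
      by (intro indep_varsD[OF ind]) (use x in auto)
    also have "\<dots> = (1 / n) ^ Suc t"
      by (simp add: unif x)
    finally show ?thesis .
  qed
  have "prob {w \<in> space M. \<forall>s\<le>Suc t. Z s w = x s} =
      prob {w \<in> space M. \<forall>s\<le>t. Z s w = x s} * pmf (pmf_of_set (({..<n} \<times> {..<n}) `` {x t})) (x (Suc t))"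
    if x: "\<forall>s\<le>Suc t. x s < n" for t x
  proof -
    have "({..<n} \<times> {..<n}) `` {x t} = {..<n}" using x by auto
    then have "pmf (pmf_of_set (({..<n} \<times> {..<n}) `` {x t})) (x (Suc t)) = 1 / n"
      using x assms(1) by (simp add: lessThan_empty_iff)
    then show ?thesis
      using x by (simp add: cyl)
  qed
  then show ?thesis
    unfolding random_walk_def complete_loop_graph_def using Z by simp
qed

text \<open>
  The image under \<open>f\<close> of the uniform distribution on \<open>A\<close> is the uniform distribution on \<open>B\<close>.
  It is phrased as equality of fibre sizes, which are easy to count.
\<close>

definition equidistributes :: "('a \<Rightarrow> 'b) \<Rightarrow> 'a set \<Rightarrow> 'b set \<Rightarrow> bool" where
  "equidistributes f A B \<longleftrightarrow>
     f \<in> A \<rightarrow> B \<and> (\<forall>b\<in>B. card {a \<in> A. f a = b} * card B = card A)"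

lemma equidistributes_comp_bij:
  assumes h: "bij_betw h A A'" and f: "equidistributes f A' B"
  shows "equidistributes (f \<circ> h) A B"
proof -
  have "card {a \<in> A. f (h a) = b} = card {a \<in> A'. f a = b}" for b
    by (rule bij_betw_same_card[of h], rule bij_betw_subset[OF h])
      (use h in \<open>auto simp: bij_betw_def\<close>)
  moreover have "card A = card A'" by (rule bij_betw_same_card[OF h])
  moreover have "h \<in> A \<rightarrow> A'" using h by (auto simp: bij_betw_def)
  ultimately show ?thesis
    using f by (auto simp: equidistributes_def)
qed

text \<open>
  The look-ahead \<open>g c\<close> may depend on the coordinate but not on the time, so different
  times \<open>s\<close> read disjoint parts of the array \<open>V\<close>; hence the positions are independent.
\<close>

lemma (in prob_space) random_walk_of_readings:
  fixes V :: "nat \<times> 'c \<Rightarrow> 'a \<Rightarrow> 'v" and g :: "'c \<Rightarrow> nat"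
  assumes ind: "indep_vars (\<lambda>i. count_space (Q (snd i))) V UNIV"
    and unif: "\<And>i v. v \<in> Q (snd i) \<Longrightarrow> prob (V i -` {v} \<inter> space M) = 1 / card (Q (snd i))"
    and C: "finite C" "C \<noteq> {}" and Q: "\<And>c. finite (Q c)" "\<And>c. Q c \<noteq> {}"
    and F: "equidistributes F (PiE C Q) {..<n}" and n: "0 < n"
  shows "random_walk M (complete_loop_graph n) (\<lambda>s w. F (\<lambda>c\<in>C. V (s + g c, c) w))"
proof (rule random_walk_of_iid_uniform[OF n])
  let ?K = "\<lambda>s. (\<lambda>c. (s + g c, c)) ` C"
  let ?G = "\<lambda>s \<rho>. F (\<lambda>c\<in>C. \<rho> (s + g c, c))"
  have "indep_vars (\<lambda>s. PiM (?K s) (\<lambda>i. count_space (Q (snd i)))) 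
      (\<lambda>s w. restrict (\<lambda>i. V i w) (?K s)) UNIV"
    by (rule indep_vars_restrict[OF ind]) (auto simp: disjoint_family_on_def)
  moreover have "PiM (?K s) (\<lambda>i. count_space (Q (snd i))) = count_space (PiE (?K s) (\<lambda>i. Q (snd i)))" for s
    by (rule count_space_PiM_finite) (use C Q in \<open>auto intro: countable_finite\<close>)
  ultimately have "indep_vars (\<lambda>s. count_space (PiE (?K s) (\<lambda>i. Q (snd i)))) 
      (\<lambda>s w. restrict (\<lambda>i. V i w) (?K s)) UNIV"
    by simp
  then have "indep_vars (\<lambda>_. count_space {..<n}) 
      (\<lambda>s w. ?G s (restrict (\<lambda>i. V i w) (?K s))) UNIV"
  proof (rule indep_vars_compose2)
    fix s
    have "?G s \<rho> \<in> {..<n}" if "\<rho> \<in> PiE (?K s) (\<lambda>i. Q (snd i))" for \<rho>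
    proof -
      have "(\<lambda>c\<in>C. \<rho> (s + g c, c)) \<in> PiE C Q"
        using that by (fastforce simp: PiE_iff)
      then show ?thesis using F unfolding equidistributes_def by blast
    qed
    then show "?G s \<in> count_space (PiE (?K s) (\<lambda>i. Q (snd i))) \<rightarrow>\<^sub>M count_space {..<n}"
      by simp
  qed
  then show "indep_vars (\<lambda>_. count_space {..<n}) (\<lambda>s w. F (\<lambda>c\<in>C. V (s + g c, c) w)) UNIV"
    by (simp cong: restrict_cong)
next
  fix s x assume x: "x < n"
  let ?A = "{u \<in> PiE C Q. F u = x}"
  have V: "V i w \<in> Q (snd i)" if "w \<in> space M" for i w
  proof -
    have "V i \<in> M \<rightarrow>\<^sub>M count_space (Q (snd i))"
      using ind unfolding indep_vars_def by blast
    from measurable_space[OF this that] show ?thesis by simp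
  qed
  have "(\<lambda>w. F (\<lambda>c\<in>C. V (s + g c, c) w)) -` {x} \<inter> space M =
      {w \<in> space M. (\<lambda>c\<in>C. V (s + g c, c) w) \<in> ?A}"
    using V by (fastforce simp: PiE_iff)
  also have "prob \<dots> = card ?A / card (PiE C Q)"
    by (rule prob_finite_block[OF ind unif C Q(1)]) auto
  also have "\<dots> = 1 / n"
  proof -
    have "card ?A * n = card (PiE C Q)"
      using F x by (auto simp: equidistributes_def)
    moreover have "card (PiE C Q) \<noteq> 0"
      using C Q by (simp add: card_PiE)
    ultimately show ?thesis using n 
      by (metis (no_types, lifting) nonzero_divide_mult_cancel_left mult.commute of_nat_mult mult_eq_0_iff of_nat_eq_0_iff)
  qed
  finally show "prob ((\<lambda>w. F (\<lambda>c\<in>C. V (s + g c, c) w)) -` {x} \<inter> space M) = 1 / n" .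
qed

lemma indep_vars_product_coordinates:
  assumes "\<And>i. finite (R i)" "\<And>i. R i \<noteq> {}"
  defines "M \<equiv> PiM UNIV (\<lambda>i. uniform_count_measure (R i))"
  shows "prob_space.indep_vars M (\<lambda>i. count_space (R i)) (\<lambda>i w. w i) UNIV"
    and "v \<in> R i \<Longrightarrow> measure M ((\<lambda>w. w i) -` {v} \<inter> space M) = 1 / card (R i)"
    and "prob_space M"
proof -
  interpret product_prob_space "\<lambda>i. uniform_count_measure (R i)" UNIV
    using assms by (intro product_prob_spaceI prob_space_uniform_count_measure)
  show P: "prob_space M" unfolding M_def by (rule prob_space_axioms)
  have s: "sets (PiM UNIV (\<lambda>i. count_space (R i))) = sets M"
    unfolding M_def by (intro sets_PiM_cong) (simp_all add: sets_uniform_count_measure_count_space)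
  have comp: "distr M (count_space (R i)) (\<lambda>w. w i) = uniform_count_measure (R i)" for i
  proof -
    have "distr M (count_space (R i)) (\<lambda>w. w i) = distr M (uniform_count_measure (R i)) (\<lambda>w. w i)"
      by (rule distr_cong) (simp_all add: sets_uniform_count_measure_count_space)
    then show ?thesis using PiM_component[of i] by (simp add: M_def)
  qed
  have rv: "(\<lambda>w. w i) \<in> M \<rightarrow>\<^sub>M count_space (R i)" for i
  proof -
    have "(\<lambda>w. w i) \<in> M \<rightarrow>\<^sub>M uniform_count_measure (R i)"
      unfolding M_def by measurable
    then show ?thesis
      using measurable_cong_sets[OF refl sets_uniform_count_measure_count_space] by blast
  qed
  have "distr M (PiM UNIV (\<lambda>i. count_space (R i))) (\<lambda>w. w) = distr M M (\<lambda>w. w)"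
    by (rule distr_cong) (simp_all add: s)
  then show "prob_space.indep_vars M (\<lambda>i. count_space (R i)) (\<lambda>i w. w i) UNIV"
    by (subst prob_space.indep_vars_iff_distr_eq_PiM'[OF P])
      (simp_all add: rv comp restrict_UNIV M_def[symmetric])
  show "measure M ((\<lambda>w. w i) -` {v} \<inter> space M) = 1 / card (R i)" if "v \<in> R i"
    using that assms(1) measure_distr[OF rv, of "{v}" i]
    by (simp add: comp measure_uniform_count_measure)
qed

text \<open>
  The sample points of a coupling can be relabelled along an injection; this
  replaces an arbitrary sample space by the type of joint trajectories.
\<close>

lemma has_avoidance_coupling_embed:
  fixes M :: "'w measure" and G :: "'v ugraph" and h :: "'w \<Rightarrow> nat \<Rightarrow> nat \<Rightarrow> 'v"
  assumes M: "avoidance_coupling M G k X" and h: "inj h"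
  shows "has_avoidance_coupling G k"
proof -
  let ?M = "embed_measure M h" and ?X = "\<lambda>j t w. X j t (inv h w)"
  have P: "prob_space M" using M by (auto simp: avoidance_coupling_def coupling_def)
  have hm: "h \<in> M \<rightarrow>\<^sub>M ?M" by (rule measurable_embed_measure2[OF h])
  have ms: "measure ?M {w \<in> space ?M. \<forall>s\<le>t. ?X j s w = x s} =
      measure M {w \<in> space M. \<forall>s\<le>t. X j s w = x s}"
    if "\<And>t. X j t \<in> M \<rightarrow>\<^sub>M count_space V" "\<And>s. s \<le> t \<Longrightarrow> x s \<in> V" for j t x V
  proof -
    let ?E = "{w \<in> space M. \<forall>s\<le>t. X j s w = x s}"
    have "?E = (\<Inter>s\<in>{..t}. X j s -` {x s} \<inter> space M)" by auto
    also have "\<dots> \<in> sets M"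
      by (intro sets.finite_INT measurable_sets[OF that(1)]) (use that(2) in auto)
    finally have E: "?E \<in> sets M" .
    have *: "{w \<in> space ?M. \<forall>s\<le>t. ?X j s w = x s} = h ` ?E"
    proof (intro equalityI subsetI)
      fix w assume "w \<in> {w \<in> space ?M. \<forall>s\<le>t. ?X j s w = x s}"
      then obtain w' where "w = h w'" "w' \<in> space M" "\<forall>s\<le>t. ?X j s w = x s"
        unfolding space_embed_measure by blast
      then show "w \<in> h ` ?E" by (simp add: inv_f_f[OF h])
    next
      fix w assume "w \<in> h ` ?E"
      then obtain w' where "w = h w'" "w' \<in> ?E" by blast
      then show "w \<in> {w \<in> space ?M. \<forall>s\<le>t. ?X j s w = x s}"
        by (simp add: inv_f_f[OF h] space_embed_measure)
    qed
    have "emeasure ?M (h ` ?E) = emeasure M (h -` (h ` ?E) \<inter> space M)"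
      by (rule emeasure_embed_measure[OF h in_sets_embed_measure[OF E]])
    moreover have "h -` (h ` ?E) \<inter> space M = ?E"
      unfolding inj_vimage_image_eq[OF h] by blast
    ultimately show ?thesis unfolding * measure_def by (simp only:)
  qed
  have "prob_space ?M"
    by (subst embed_measure_eq_distr[OF h]) (rule prob_space.prob_space_distr[OF P hm])
  moreover have "random_walk ?M G (?X j)" if "j \<in> {1..k}" for j
  proof -
    have W: "random_walk M G (X j)"
      using M that by (auto simp: avoidance_coupling_def coupling_def)
    then have X: "X j t \<in> M \<rightarrow>\<^sub>M count_space (fst G)" for t
      by (auto simp: random_walk_def)
    have "?X j t \<in> ?M \<rightarrow>\<^sub>M count_space (fst G)" for t
      by (rule measurable_embed_measure1) (simp only: inv_f_f[OF h] X)
    moreover have "measure ?M {w \<in> space ?M. \<forall>s\<le>Suc t. ?X j s w = x s} =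
        measure ?M {w \<in> space ?M. \<forall>s\<le>t. ?X j s w = x s} *
          pmf (pmf_of_set (snd G `` {x t})) (x (Suc t))"
      if x: "\<forall>s\<le>Suc t. x s \<in> fst G" for t x
    proof -
      have "measure ?M {w \<in> space ?M. \<forall>s\<le>t'. ?X j s w = x s} =
          measure M {w \<in> space M. \<forall>s\<le>t'. X j s w = x s}" if "t' \<le> Suc t" for t'
        by (rule ms[OF X]) (use x that in auto)
      note eq = this[of t, OF le_SucI[OF order_refl]] this[OF order_refl]
      show ?thesis
        unfolding eq using W x unfolding random_walk_def by blast
    qed
    ultimately show ?thesis unfolding random_walk_def by blast
  qed
  moreover have "AE w in ?M. \<forall>t. \<forall>i\<in>{1..k}. \<forall>j\<in>{1..k}.
        (i \<noteq> j \<longrightarrow> ?X i t w \<noteq> ?X j t w) \<and> (i < j \<longrightarrow> ?X i (Suc t) w \<noteq> ?X j t w)"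
    using M unfolding AE_embed_measure[OF h] inv_f_f[OF h] avoidance_coupling_def by (rule conjunct2)
  ultimately have "avoidance_coupling ?M G k ?X"
    unfolding avoidance_coupling_def coupling_def by blast
  then show ?thesis unfolding has_avoidance_coupling_def by blast
qed

section \<open>From arrays to vertices\<close>

text \<open>
  The coin of success probability \<open>m / n\<close> is the event \<open>e < m\<close> for \<open>e\<close> uniform below \<open>n\<close>.
\<close>

definition select :: "nat \<Rightarrow> nat \<Rightarrow> nat \<times> nat \<times> nat \<Rightarrow> nat" where
  "select m n = (\<lambda>(y, z, e). if z < n - m \<and> e < m then m + z else y)"

text \<open>
  Every fibre has \<open>m * m\<close> elements.  A vertex \<open>m + z\<close> leaves \<open>m\<close> choices for \<open>y\<close> and \<open>m\<close> for
  \<open>e\<close>; a vertex below \<open>m\<close> fixes \<open>y\<close> and leaves the \<open>m * n - (n - m) * m\<close> pairs \<open>(z, e)\<close>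
  that do not lead beyond \<open>m\<close>.
\<close>

lemma equidistributes_select:
  assumes "m \<le> n" "n \<le> 2 * m"
  shows "equidistributes (select m n) ({..<m} \<times> {..<m} \<times> {..<n}) {..<n}"
proof -
  let ?A = "{..<m} \<times> {..<m} \<times> {..<n}"
  have "card {a \<in> ?A. select m n a = x} = m * m" if "x < n" for x
  proof (cases "x < m")
    case True
    have "{a \<in> ?A. select m n a = x} = {x} \<times> (({..<m} \<times> {..<n}) - {..<n - m} \<times> {..<m})"
      using True by (auto simp: select_def split: if_splits)
    moreover have "card (({..<m} \<times> {..<n}) - {..<n - m} \<times> {..<m}) = m * n - (n - m) * m"
      using assms by (subst card_Diff_subset) auto
    moreover have "m * n - (n - m) * m = m * m"
      using assms by (metis diff_diff_cancel diff_mult_distrib2 mult.commute)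
    ultimately show ?thesis by simp
  next
    case False
    then have "{a \<in> ?A. select m n a = x} = {..<m} \<times> {x - m} \<times> {..<m}"
      using that assms by (auto simp: select_def split: if_splits)
    then show ?thesis by simp
  qed
  moreover have "select m n \<in> ?A \<rightarrow> {..<n}"
    using assms by (auto simp: select_def split: if_splits)
  ultimately show ?thesis
    by (simp add: equidistributes_def)
qed

lemma select_neq:
  assumes "y < m" "y' < m" "y \<noteq> y'" "z \<noteq> z'"
  shows "select m n (y, z, e) \<noteq> select m n (y', z', e')"
  using assms by (auto simp: select_def)

text \<open>
  An array symbol carries one bit for each of the two copies of the coupling.  The coin is
  stored in the symbols of coordinate \<open>0\<close> only; the dummy value \<open>0\<close> elsewhere makes the
  number of symbol vectors equal to \<open>m * m * n\<close>.
\<close>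

definition symbols :: "nat \<Rightarrow> nat \<Rightarrow> (bool \<times> bool \<times> nat) set" where
  "symbols n c = UNIV \<times> UNIV \<times> (if c = 0 then {..<n} else {0})"

text \<open>
  Negating both bits at once lets one word steer both copies.
\<close>

definition twist :: "bool \<Rightarrow> bool \<times> bool \<times> nat \<Rightarrow> bool \<times> bool \<times> nat" where
  "twist s = (\<lambda>(a, b, e). (a \<noteq> s, b \<noteq> s, e))"

text \<open>
  A bijection \<open>\<beta>\<close> numbers the bit vectors by the vertices below \<open>m\<close>.
\<close>

definition address ::
    "((nat \<Rightarrow> bool) \<Rightarrow> nat) \<Rightarrow> nat \<Rightarrow> (nat \<Rightarrow> bool \<times> bool \<times> nat) \<Rightarrow> nat \<times> nat \<times> nat" where
  "address \<beta> d u =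
     (\<beta> (\<lambda>c\<in>{..d}. fst (u c)), \<beta> (\<lambda>c\<in>{..d}. fst (snd (u c))), snd (snd (u 0)))"

lemma finite_symbols [simp]: "finite (symbols n c)"
  by (simp add: symbols_def)

lemma symbols_nonempty: "0 < n \<Longrightarrow> symbols n c \<noteq> {}"
  by (auto simp: symbols_def)

lemma card_PiE_symbols: "card (PiE {..d} (symbols n)) = 2 ^ Suc d * (2 ^ Suc d * n)"
proof (induction d)
  case 0
  then show ?case by (simp add: card_PiE symbols_def card_cartesian_product)
next
  case (Suc d)
  then show ?case by (simp add: card_PiE symbols_def card_cartesian_product)
qed

text \<open>
  The address is injective because it retains both bits of every coordinate and the coin;
  counting gives surjectivity.
\<close>

lemma bij_betw_address:
  fixes \<beta> :: "(nat \<Rightarrow> bool) \<Rightarrow> nat"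
  assumes \<beta>: "bij_betw \<beta> (PiE {..d} (\<lambda>_. UNIV)) {..<2 ^ Suc d}"
  shows "bij_betw (address \<beta> d) (PiE {..d} (symbols n)) ({..<2 ^ Suc d} \<times> {..<2 ^ Suc d} \<times> {..<n})"
proof -
  let ?A = "PiE {..d} (symbols n)" and ?B = "{..<2 ^ Suc d :: nat} \<times> {..<2 ^ Suc d :: nat} \<times> {..<n}"
  have inj: "inj_on (address \<beta> d) ?A"
  proof (rule inj_onI)
    fix u v assume uv: "u \<in> ?A" "v \<in> ?A" "address \<beta> d u = address \<beta> d v"
    then have *: "(\<lambda>c\<in>{..d}. fst (u c)) = (\<lambda>c\<in>{..d}. fst (v c))"
      "(\<lambda>c\<in>{..d}. fst (snd (u c))) = (\<lambda>c\<in>{..d}. fst (snd (v c)))" "snd (snd (u 0)) = snd (snd (v 0))"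
      using inj_onD[OF bij_betw_imp_inj_on[OF \<beta>]] by (auto simp: address_def)
    show "u = v"
    proof (rule PiE_ext[OF uv(1,2)])
      fix c assume c: "c \<in> {..d}"
      have "u c \<in> symbols n c" "v c \<in> symbols n c" using uv c by auto
      moreover have "fst (u c) = fst (v c)" "fst (snd (u c)) = fst (snd (v c))"
        using fun_cong[OF *(1), of c] fun_cong[OF *(2), of c] c by auto
      ultimately show "u c = v c"
        using *(3) by (cases "c = 0") (auto simp: symbols_def prod_eq_iff)
    qed
  qed
  have sub: "address \<beta> d ` ?A \<subseteq> ?B"
  proof
    fix a assume "a \<in> address \<beta> d ` ?A"
    then obtain u where u: "u \<in> ?A" "a = address \<beta> d u" by blast
    have "u 0 \<in> symbols n 0" using u(1) by auto
    moreover have "\<beta> (\<lambda>c\<in>{..d}. f c) \<in> {..<2 ^ Suc d}" for f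
      using \<beta> by (rule bij_betw_apply) simp
    ultimately show "a \<in> ?B"
      unfolding u(2) address_def by (auto simp: symbols_def simp del: power_Suc)
  qed
  have "card (address \<beta> d ` ?A) = card ?B"
    by (simp add: card_image[OF inj] card_PiE_symbols card_cartesian_product del: power_Suc)
  then have "address \<beta> d ` ?A = ?B"
    by (intro card_subset_eq sub) auto
  then show ?thesis using inj by (simp add: bij_betw_def)
qed

lemma bij_betw_twist:
  "bij_betw (\<lambda>u. \<lambda>c\<in>{..d}. twist (\<sigma> c) (u c)) (PiE {..d} (symbols n)) (PiE {..d} (symbols n))"
proof (rule bij_betwI)
  have inv: "twist s (twist s a) = a" for s a by (auto simp: twist_def split: prod.splits)
  have clo: "twist s a \<in> symbols n c" if "a \<in> symbols n c" for s a c
    using that by (auto simp: twist_def symbols_def split: if_splits)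
  show maps: "(\<lambda>u. \<lambda>c\<in>{..d}. twist (\<sigma> c) (u c)) \<in> PiE {..d} (symbols n) \<rightarrow> PiE {..d} (symbols n)"
    by (auto intro!: clo)
  then show "(\<lambda>u. \<lambda>c\<in>{..d}. twist (\<sigma> c) (u c)) \<in> PiE {..d} (symbols n) \<rightarrow> PiE {..d} (symbols n)" .
  fix u assume "u \<in> PiE {..d} (symbols n)"
  then show "(\<lambda>c\<in>{..d}. twist (\<sigma> c) ((\<lambda>c\<in>{..d}. twist (\<sigma> c) (u c)) c)) = u"
    by (intro extensionalityI[of _ "{..d}"]) (auto simp: inv PiE_def)
  then show "(\<lambda>c\<in>{..d}. twist (\<sigma> c) ((\<lambda>c\<in>{..d}. twist (\<sigma> c) (u c)) c)) = u" .
qed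

text \<open>
  A single symbol read with opposite signs differs in both bits, so both copies
  differ, as \<open>select_neq\<close> requires.
\<close>

lemma address_neq:
  fixes \<beta> :: "(nat \<Rightarrow> bool) \<Rightarrow> nat"
  assumes \<beta>: "bij_betw \<beta> (PiE {..d} (\<lambda>_. UNIV)) {..<2 ^ Suc d}"
    and c: "c \<le> d" and uv: "u c = twist s a" "v c = twist (\<not> s) a"
  shows "select (2 ^ Suc d) n (address \<beta> d u) \<noteq> select (2 ^ Suc d) n (address \<beta> d v)"
proof -
  have ne: "\<beta> (\<lambda>c\<in>{..d}. f c) \<noteq> \<beta> (\<lambda>c\<in>{..d}. f' c)" if "f c \<noteq> f' c" for f f'
  proof
    assume "\<beta> (\<lambda>c\<in>{..d}. f c) = \<beta> (\<lambda>c\<in>{..d}. f' c)"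
    then have "(\<lambda>c\<in>{..d}. f c) = (\<lambda>c\<in>{..d}. f' c)"
      by (rule inj_onD[OF bij_betw_imp_inj_on[OF \<beta>]]) auto
    from fun_cong[OF this, of c] show False using that c by simp
  qed
  have lt: "\<beta> (\<lambda>c\<in>{..d}. f c) < 2 ^ Suc d" for f
    using bij_betw_apply[OF \<beta>, of "\<lambda>c\<in>{..d}. f c"] by (simp del: power_Suc)
  show ?thesis
    unfolding address_def
    by (intro select_neq lt ne) (simp_all add: uv twist_def split: prod.splits)
qed

section \<open>The coupling\<close>

definition reading ::
    "nat \<Rightarrow> (nat \<times> nat \<Rightarrow> bool \<times> bool \<times> nat) \<Rightarrow> (nat \<times> bool) list \<Rightarrow> nat \<Rightarrow> nat \<Rightarrow> bool \<times> bool \<times> nat" where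
  "reading d \<omega> w t = (\<lambda>c\<in>{..d}. twist (snd (w ! c)) (\<omega> (t + fst (w ! c), c)))"

theorem corollary6p2:
  fixes n k :: nat
  assumes "n \<ge> 1" and "k \<ge> 1" and "real k \<le> real n / 4"
  shows "has_avoidance_coupling (complete_loop_graph n) k"
proof -
  have kn: "4 * k \<le> n" using assms(3) by linarith
  obtain e where e: "2 ^ e \<le> n" "n < 2 ^ Suc e"
    using ex_power_ivl1[of 2 n] assms(1) by auto
  have "e \<noteq> 0" using e kn assms(2) by (intro notI) simp
  then obtain d where d: "e = Suc d" by (cases e) auto
  \<comment> \<open>The slack in \<open>4 * k \<le> n < 4 * 2 ^ d\<close> pays for rounding \<open>n\<close> down to a power of two.\<close>
  define m :: nat where "m = 2 ^ Suc d"
  have m: "m \<le> n" "n \<le> 2 * m" and k: "k \<le> 2 ^ d"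
    using e kn by (simp_all add: d m_def)
  have "card (PiE {..d} (\<lambda>_. UNIV :: bool set)) = card {..<m}"
    by (simp add: card_PiE m_def)
  then obtain \<beta> :: "(nat \<Rightarrow> bool) \<Rightarrow> nat" where \<beta>: "bij_betw \<beta> (PiE {..d} (\<lambda>_. UNIV)) {..<m}"
    by (meson finite_PiE finite_same_card_bij finite_atMost finite_lessThan finite)
  \<comment> \<open>Walkers are numbered from \<open>1\<close>, list entries from \<open>0\<close>.\<close>
  define word where "word j = family False d ! (j - 1)" for j
  define vertex where "vertex u = select m n (address \<beta> d u)" for u
  define X where "X j t \<omega> = vertex (reading d \<omega> (word j) t)" for j t \<omega>
  define M where "M = PiM UNIV (\<lambda>i :: nat \<times> nat. uniform_count_measure (symbols n (snd i)))"
  have n: "0 < n" using assms(1) by simp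
  note M_props = indep_vars_product_coordinates[of "\<lambda>i :: nat \<times> nat. symbols n (snd i)", OF _ symbols_nonempty[OF n], folded M_def]
  interpret prob_space M
    by (rule M_props(3)) simp

  have walk: "random_walk M (complete_loop_graph n) (X j)" for j
  proof -
    let ?tw = "\<lambda>u. \<lambda>c\<in>{..d}. twist (snd (word j ! c)) (u c)"
    have "equidistributes (select m n \<circ> address \<beta> d) (PiE {..d} (symbols n)) {..<n}"
      by (rule equidistributes_comp_bij[OF _ equidistributes_select[OF m]])
        (use bij_betw_address \<beta> in \<open>simp add: m_def\<close>)
    then have F: "equidistributes ((select m n \<circ> address \<beta> d) \<circ> ?tw) (PiE {..d} (symbols n)) {..<n}"
      by (rule equidistributes_comp_bij[OF bij_betw_twist])
    have "random_walk M (complete_loop_graph n) (\<lambda>t \<omega>. ((select m n \<circ> address \<beta> d) \<circ> ?tw)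
        (\<lambda>c\<in>{..d}. \<omega> (t + fst (word j ! c), c)))"
      by (rule random_walk_of_readings[where Q = "symbols n" and V = "\<lambda>i \<omega>. \<omega> i"
            and C = "{..d}" and g = "\<lambda>c. fst (word j ! c)",
            OF M_props(1,2) finite_atMost _ finite_symbols symbols_nonempty[OF n] F n]) auto
    also have "(\<lambda>t \<omega>. ((select m n \<circ> address \<beta> d) \<circ> ?tw) (\<lambda>c\<in>{..d}. \<omega> (t + fst (word j ! c), c))) = X j"
      by (simp add: X_def vertex_def reading_def fun_eq_iff cong: restrict_cong)
    finally show ?thesis .
  qed
  have apart: "X i t \<omega> \<noteq> X j t \<omega> \<and> X i (Suc t) \<omega> \<noteq> X j t \<omega>"
    if ij: "1 \<le> i" "i < j" "j \<le> k" for i j t \<omega>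
  proof -
    let ?F = "family False d"
    have len: "i - 1 < j - 1" "j - 1 < length ?F" using ij k by auto
    then have "separated (word i) (word j)"
      unfolding word_def by (rule sorted_wrt_nth_less[OF family_separated])
    moreover have "length (word i) = Suc d"
      unfolding word_def by (rule length_word_family[of _ False]) (use len in auto)
    ultimately obtain c c' where
      c: "c \<le> d" "word j ! c = flip (word i ! c)" and
      c': "c' \<le> d" "word j ! c' = advance (word i ! c')"
      by (auto simp: separated_def set_zip less_Suc_eq_le)
    have "X i t \<omega> \<noteq> X j t \<omega>"
      unfolding X_def vertex_def m_def
      by (rule address_neq[OF \<beta>[unfolded m_def] c(1)])
        (use c in \<open>simp_all add: reading_def flip_def\<close>)
    moreover have "X i (Suc t) \<omega> \<noteq> X j t \<omega>"
      unfolding X_def vertex_def m_def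
      by (rule address_neq[OF \<beta>[unfolded m_def] c'(1)])
        (use c' in \<open>simp_all add: reading_def advance_def\<close>)
    ultimately show ?thesis ..
  qed
  have "AE \<omega> in M. \<forall>t. \<forall>i\<in>{1..k}. \<forall>j\<in>{1..k}.
      (i \<noteq> j \<longrightarrow> X i t \<omega> \<noteq> X j t \<omega>) \<and> (i < j \<longrightarrow> X i (Suc t) \<omega> \<noteq> X j t \<omega>)"
  proof (intro AE_I2 allI ballI conjI impI)
    fix \<omega> t i j assume ij: "i \<in> {1..k}" "j \<in> {1..k}"
    show "X i t \<omega> \<noteq> X j t \<omega>" if "i \<noteq> j"
      using apart[of i j t \<omega>] apart[of j i t \<omega>] ij that by (cases i j rule: linorder_cases) auto
    show "X i (Suc t) \<omega> \<noteq> X j t \<omega>" if "i < j"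
      using apart[of i j t \<omega>] ij that by auto
  qed
  then have "avoidance_coupling M (complete_loop_graph n) k X"
    using walk prob_space_axioms by (simp add: avoidance_coupling_def coupling_def)
  moreover have "inj (\<lambda>(\<omega> :: nat \<times> nat \<Rightarrow> bool \<times> bool \<times> nat) s c. to_nat (\<omega> (s, c)))"
    by (auto simp: inj_def fun_eq_iff)
  ultimately show ?thesis
    by (rule has_avoidance_coupling_embed)
qed

end
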